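(* Let $n\in\mathbb{N}$ and let $\mathcal{L}$ be a finite set of rectangular polyominoes. If every element of $\mathcal{L}$ has height either $1$ or at least $n-1$, then $\mathcal{L}$ is $n$-representable. Furthermore, if $n=4$, then any finite set of rectangular polyominoes in which all of the polyominoes of height two have the same width is $n$-representable (i.e. $4$-representable).
   Context: $p_{a\times b}$ denotes the rectangular polyomino of height $a$ and width $b$, and $R_{n\times m}$ the rectangular region of height $n$ (rows numbered $1,\dots,n$) and width $m$. Let $I(n)$ be the set of non-empty contiguous intervals of $\{1,\dots,n\}$. A finite set $\mathcal{L}$ of rectangular polyominoes is $n$-representable if for every $m$ and every finite multiset $\mathcal{P}$ of pairs $(p_{a\times b},\iota)$ with $p_{a\times b}\in\mathcal{L}$ and $\iota\in I(n)$ having exactly $a$ elements, whenever $$\sum_{(p_{a\times b},\iota)\in\mathcal{P}}ab=nm\quad\text{and}\quad\sum_{(p_{a\times b},\iota)\in\mathcal{P},\ i\in\iota}b=m\ \text{ for all }1\le i\le n,$$ there is a tiling of $R_{n\times m}$ by translates of the polyominoes of $\mathcal{P}$ (covering every point, with no two-dimensional overlaps between different elements) in which each $(p_{a\times b},\iota)$ occupies exactly the rows in $\iota$. *)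

theory Defs
  imports "HOL-Analysis.Analysis" "HOL-Library.Multiset"
begin

text \<open>
  The plane is \<open>real \<times> real\<close>, with points \<open>(x, y)\<close>: \<open>x\<close> is the horizontal and \<open>y\<close> the vertical
  coordinate. Row \<open>i\<close> is the strip \<open>i - 1 \<le> y \<le> i\<close> and column \<open>j\<close> the strip \<open>j - 1 \<le> x \<le> j\<close>.
\<close>

definition unit_square :: "nat \<Rightarrow> nat \<Rightarrow> (real \<times> real) set" where
  "unit_square i j = {real j - 1..real j} \<times> {real i - 1..real i}"

text \<open>
  \<open>rect_region a b\<close> is the union of the unit squares in rows \<open>1, \<dots>, a\<close> and columns \<open>1, \<dots>, b\<close>. It
  serves both as the region $R_{a \times b}$ and as the polyomino $p_{a \times b}$ in standard
  position. It is empty, not a segment, if \<open>a = 0\<close> or \<open>b = 0\<close>.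
\<close>

definition rect_region :: "nat \<Rightarrow> nat \<Rightarrow> (real \<times> real) set" where
  "rect_region a b = (\<Union>i\<in>{1..a}. \<Union>j\<in>{1..b}. unit_square i j)"

text \<open>A rectangular polyomino is given by its dimensions \<open>(height, width)\<close>.\<close>

type_synonym rect_poly = "nat \<times> nat"

definition rect_polyominoes :: "rect_poly set" where
  "rect_polyominoes = {(a, b). 1 \<le> a \<and> 1 \<le> b}"

definition intervals :: "nat \<Rightarrow> nat set set" where
  "intervals n = {{i..j} | i j. 1 \<le> i \<and> i \<le> j \<and> j \<le> n}"

definition translate :: "real \<times> real \<Rightarrow> (real \<times> real) set \<Rightarrow> (real \<times> real) set" where
  "translate v S = (\<lambda>z. v + z) ` S"

definition occupies_exactly_rows :: "(real \<times> real) set \<Rightarrow> nat set \<Rightarrow> bool" where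
  "occupies_exactly_rows S \<iota> \<longleftrightarrow> snd ` S = (\<Union>i\<in>\<iota>. {real i - 1..real i})"

text \<open>
  A placement of the multiset \<open>P\<close> enumerates its elements, with multiplicity, as a list \<open>ps\<close> and
  moves the \<open>k\<close>-th one by the vector \<open>v k\<close>; indexing by \<open>k\<close> makes equal copies count as different
  elements. The vectors are arbitrary: in a tiling they are forced to be integral, since the rows
  prescribe the vertical position and each row is filled by segments of integer length.
\<close>

definition has_tiling :: "nat \<Rightarrow> nat \<Rightarrow> (rect_poly \<times> nat set) multiset \<Rightarrow> bool" where
  "has_tiling n m P \<longleftrightarrow>
    (\<exists>(ps :: (rect_poly \<times> nat set) list) (v :: nat \<Rightarrow> real \<times> real) (T :: nat \<Rightarrow> (real \<times> real) set).
       mset ps = P \<and>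
       (\<forall>k<length ps. case ps ! k of ((a, b), \<iota>) \<Rightarrow>
          T k = translate (v k) (rect_region a b) \<and> occupies_exactly_rows (T k) \<iota>) \<and>
       (\<Union>k<length ps. T k) = rect_region n m \<and>
       (\<forall>k<length ps. \<forall>l<length ps. k \<noteq> l \<longrightarrow> interior (T k \<inter> T l) = {}))"

definition n_representable :: "nat \<Rightarrow> rect_poly set \<Rightarrow> bool" where
  "n_representable n L \<longleftrightarrow>
    (\<forall>(m :: nat) (P :: (rect_poly \<times> nat set) multiset).
       (\<forall>((a, b), \<iota>) \<in> set_mset P. (a, b) \<in> L \<and> \<iota> \<in> intervals n \<and> card \<iota> = a) \<and>
       (\<Sum>((a, b), \<iota>) \<in># P. a * b) = n * m \<and>
       (\<forall>i\<in>{1..n}. (\<Sum>((a, b), \<iota>) \<in># filter_mset (\<lambda>(p, \<iota>). i \<in> \<iota>) P. b) = m)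
       \<longrightarrow> has_tiling n m P)"

end

(* A packing grows from the left and from the right wall, where row i of the region still to be
   filled is the column interval [l i, r i). A piece can be pushed against the left (right) wall if
   that wall is straight on the rows of the piece, and single-row pieces can always be added last.
   For heights 1, n - 1 and n: put the pieces on all rows and those on rows 1..n-1 on the left, and
   those on rows 2..n on the right.
   For n = 4: pair as many pieces on rows {1,2} as possible with pieces on rows {3,4}; since the
   widths agree, such a pair behaves like a piece on all rows. Of the two kinds at most one, say
   {1,2}, then remains; after the pieces of height 3 have been placed as before, put the remaining
   {1,2} on the left and the pieces on rows {2,3} on the right. *)
theory Submission imports Defs begin

section \<open>Combinatorics of frontiers: integer columns only, no geometry yet\<close>

subsection \<open>Packings growing from both sides\<close>

text \<open>Integer valued, because the right frontier moves by subtraction, which must not truncate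
  at 0.\<close>

abbreviation piece_width :: "rect_poly \<times> nat set \<Rightarrow> int" where
  "piece_width p \<equiv> int (snd (fst p))"

definition row_width :: "nat \<Rightarrow> (rect_poly \<times> nat set) multiset \<Rightarrow> int" where
  "row_width i P = (\<Sum>p\<in>#P. if i \<in> snd p then piece_width p else 0)"

definition total_width :: "(rect_poly \<times> nat set) multiset \<Rightarrow> int" where
  "total_width P = (\<Sum>p\<in>#P. piece_width p)"

text \<open>The outermost piece comes first: \<open>p\<close> is pushed against a wall that is
  straight at \<open>c\<close> on its rows, and \<open>P\<close> must then fill what is left between
  the new frontiers. The base case asks the frontiers to meet, so a derivation describes an exact
  filling. That \<open>l\<close> never passes \<open>r\<close> is not imposed here but derived in
  \<open>packs_imp_placement\<close>.\<close>

inductive packs ::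
  "nat \<Rightarrow> (nat \<Rightarrow> int) \<Rightarrow> (nat \<Rightarrow> int) \<Rightarrow> (rect_poly \<times> nat set) multiset \<Rightarrow> bool" for n where
  packs_empty: "(\<And>i. i \<in> {1..n} \<Longrightarrow> l i = r i) \<Longrightarrow> packs n l r {#}"
| packs_left:
    "packs n l' r P \<Longrightarrow> snd p \<subseteq> {1..n} \<Longrightarrow> (\<And>i. i \<in> snd p \<Longrightarrow> l i = c) \<Longrightarrow>
     (\<And>i. i \<in> {1..n} \<Longrightarrow> l' i = (if i \<in> snd p then c + piece_width p else l i)) \<Longrightarrow>
     packs n l r (add_mset p P)"
| packs_right:
    "packs n l r' P \<Longrightarrow> snd p \<subseteq> {1..n} \<Longrightarrow> (\<And>i. i \<in> snd p \<Longrightarrow> r i = c) \<Longrightarrow>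
     (\<And>i. i \<in> {1..n} \<Longrightarrow> r' i = (if i \<in> snd p then c - piece_width p else r i)) \<Longrightarrow>
     packs n l r (add_mset p P)"

text \<open>Frontiers are functions on all naturals of which only the rows of the region matter;
  this allows the nested conditionals arising below to be exchanged for equal ones.\<close>

lemma packs_cong:
  assumes "packs n l r P"
    and "\<And>i. i \<in> {1..n} \<Longrightarrow> l i = l' i" "\<And>i. i \<in> {1..n} \<Longrightarrow> r i = r' i"
  shows "packs n l' r' P"
  using assms
proof (induction arbitrary: l' r' rule: packs.induct)
  case (packs_empty l r)
  then show ?case by (auto intro!: packs.packs_empty)
next
  case (packs_left k r P p l c)
  have "packs n k r' P"
    using packs_left by blast
  then show ?case
  proof (rule packs.packs_left)
    show "snd p \<subseteq> {1..n}" by fact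
    show "l' i = c" if "i \<in> snd p" for i
      using packs_left that by (metis subsetD)
    show "k i = (if i \<in> snd p then c + piece_width p else l' i)" if "i \<in> {1..n}" for i
      using packs_left that by simp
  qed
next
  case (packs_right l k P p r c)
  have "packs n l' k P"
    using packs_right by blast
  then show ?case
  proof (rule packs.packs_right)
    show "snd p \<subseteq> {1..n}" by fact
    show "r' i = c" if "i \<in> snd p" for i
      using packs_right that by (metis subsetD)
    show "k i = (if i \<in> snd p then c - piece_width p else r' i)" if "i \<in> {1..n}" for i
      using packs_right that by simp
  qed
qed

text \<open>A wall that is straight on \<open>\<iota>\<close> stays straight there after a piece on
  exactly these rows has been added, so a whole block can be pushed in one piece after
  another.\<close>

lemma packs_left_block:
  assumes "\<And>p. p \<in># Q \<Longrightarrow> snd p = \<iota>" "\<iota> \<subseteq> {1..n}" "\<And>i. i \<in> \<iota> \<Longrightarrow> l i = c"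
    and "packs n (\<lambda>i. if i \<in> \<iota> then c + total_width Q else l i) r P"
  shows "packs n l r (Q + P)"
  using assms
proof (induction Q arbitrary: l c)
  case empty
  then show ?case by (auto simp: total_width_def elim!: packs_cong)
next
  case (add p Q)
  define l' where "l' i = (if i \<in> \<iota> then c + piece_width p else l i)" for i
  have "packs n l' r (Q + P)"
  proof (rule add.IH)
    show "packs n (\<lambda>i. if i \<in> \<iota> then (c + piece_width p) + total_width Q else l' i) r P"
      by (rule packs_cong[OF add.prems(4)]) (auto simp: l'_def total_width_def)
  qed (use add.prems in \<open>auto simp: l'_def\<close>)
  then have "packs n l r (add_mset p (Q + P))"
    by (rule packs_left) (use add.prems in \<open>auto simp: l'_def\<close>)
  then show ?case by simp
qed

lemma packs_right_block:
  assumes "\<And>p. p \<in># Q \<Longrightarrow> snd p = \<iota>" "\<iota> \<subseteq> {1..n}" "\<And>i. i \<in> \<iota> \<Longrightarrow> r i = c"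
    and "packs n l (\<lambda>i. if i \<in> \<iota> then c - total_width Q else r i) P"
  shows "packs n l r (Q + P)"
  using assms
proof (induction Q arbitrary: r c)
  case empty
  then show ?case by (auto simp: total_width_def elim!: packs_cong)
next
  case (add p Q)
  define r' where "r' i = (if i \<in> \<iota> then c - piece_width p else r i)" for i
  have "packs n l r' (Q + P)"
  proof (rule add.IH)
    show "packs n l (\<lambda>i. if i \<in> \<iota> then (c - piece_width p) - total_width Q else r' i) P"
      by (rule packs_cong[OF add.prems(4)]) (auto simp: r'_def total_width_def)
  qed (use add.prems in \<open>auto simp: r'_def\<close>)
  then have "packs n l r (add_mset p (Q + P))"
    by (rule packs_right) (use add.prems in \<open>auto simp: r'_def\<close>)
  then show ?case by simp
qed

text \<open>On a single row every wall is straight, so the order is arbitrary and only the total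
  width in each row counts.\<close>

lemma packs_singletons:
  assumes "\<And>p. p \<in># P \<Longrightarrow> \<exists>i\<in>{1..n}. snd p = {i}"
    and "\<And>i. i \<in> {1..n} \<Longrightarrow> l i + row_width i P = r i"
  shows "packs n l r P"
  using assms
proof (induction P arbitrary: l)
  case empty
  then show ?case by (auto simp: row_width_def intro!: packs_empty)
next
  case (add p P)
  obtain j where j: "j \<in> {1..n}" "snd p = {j}"
    using add.prems(1)[of p] by auto
  have "packs n (\<lambda>i. if i \<in> snd p then l j + piece_width p else l i) r P"
  proof (rule add.IH)
    show "(if i \<in> snd p then l j + piece_width p else l i) + row_width i P = r i"
      if "i \<in> {1..n}" for i
      using add.prems(2)[OF that] j by (auto simp: row_width_def split: if_splits)
  qed (use add.prems(1) in auto)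
  then show ?case
    by (rule packs_left) (use j in auto)
qed

lemma row_width_union: "row_width i (P + Q) = row_width i P + row_width i Q"
  by (simp add: row_width_def)

lemma row_width_block:
  assumes "\<And>p. p \<in># Q \<Longrightarrow> snd p = \<iota>"
  shows "row_width i Q = (if i \<in> \<iota> then total_width Q else 0)"
  using assms by (induction Q) (auto simp: row_width_def total_width_def split: if_splits)

lemma total_width_replicate: "total_width (replicate_mset k p) = int k * piece_width p"
  by (simp add: total_width_def)

section \<open>From frontiers to column positions, and from these to boxes in the plane\<close>

subsection \<open>From packings to tilings\<close>

text \<open>Reads off the left end of each piece. The bound \<open>l i \<le> r i\<close> is carried
  along because it keeps a newly pushed piece from sticking out through the opposite wall.
  \<open>sorted_wrt\<close> compares list positions, so equal copies are separated too. In the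
  covering clause \<open>j\<close> stands for the unit cell from \<open>j\<close> to
  \<open>j + 1\<close>.\<close>

lemma packs_imp_placement:
  assumes "packs n l r P"
  shows "(\<forall>i\<in>{1..n}. l i \<le> r i) \<and>
    (\<exists>qs :: ((rect_poly \<times> nat set) \<times> int) list. mset (map fst qs) = P \<and>
      (\<forall>(p, x)\<in>set qs. snd p \<subseteq> {1..n} \<and> (\<forall>i\<in>snd p. l i \<le> x \<and> x + piece_width p \<le> r i)) \<and>
      sorted_wrt (\<lambda>(p, x) (q, y). snd p \<inter> snd q = {} \<or>
        x + piece_width p \<le> y \<or> y + piece_width q \<le> x) qs \<and>
      (\<forall>i\<in>{1..n}. \<forall>j. l i \<le> j \<longrightarrow> j < r i \<longrightarrow>
        (\<exists>(p, x)\<in>set qs. i \<in> snd p \<and> x \<le> j \<and> j < x + piece_width p)))"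
    (is "_ \<and> (\<exists>qs. ?placed l r P qs)")
  using assms
proof (induction rule: packs.induct)
  case (packs_empty l r)
  then show ?case by (auto intro!: exI[of _ "[]"])
next
  case (packs_left l' r P p l c)
  then obtain qs where le: "\<forall>i\<in>{1..n}. l' i \<le> r i" and qs: "?placed l' r P qs"
    by blast
  have l': "l i = c \<and> l' i = c + piece_width p" if "i \<in> snd p" for i
    using packs_left.hyps that by auto
  have mono: "l i \<le> l' i" if "i \<in> {1..n}" for i
    using packs_left.hyps(3,4) that by auto
  have "?placed l r (add_mset p P) ((p, c) # qs)"
  proof (intro conjI)
    show "mset (map fst ((p, c) # qs)) = add_mset p P"
      using qs by simp
    have "l i \<le> x" if "(q, x) \<in> set qs" "i \<in> snd q" for q x i
    proof -
      have "i \<in> {1..n}" "l' i \<le> x"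
        using qs that by fastforce+
      then show ?thesis using mono by force
    qed
    \<comment> \<open>The right end of \<open>p\<close> is the new frontier \<open>l' i\<close>,
      which does not pass \<open>r i\<close> by induction.\<close>
    moreover have "c + piece_width p \<le> r i" if "i \<in> snd p" for i
      using l'[OF that] le packs_left.hyps(2) that by force
    ultimately show "\<forall>(q, x)\<in>set ((p, c) # qs). snd q \<subseteq> {1..n} \<and>
        (\<forall>i\<in>snd q. l i \<le> x \<and> x + piece_width q \<le> r i)"
      using qs l' packs_left.hyps(2) by fastforce
    \<comment> \<open>In a shared row \<open>i\<close> the piece \<open>q\<close> starts at
      \<open>l' i\<close> or later, and \<open>p\<close> ends at \<open>l' i\<close>.\<close>
    have "snd p \<inter> snd q = {} \<or> c + piece_width p \<le> y" if "(q, y) \<in> set qs" for q y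
    proof (cases "snd p \<inter> snd q = {}")
      case False
      then obtain i where "i \<in> snd p" "i \<in> snd q" by blast
      then show ?thesis using qs l' that by fastforce
    qed simp
    then have "\<forall>(q, y)\<in>set qs. snd p \<inter> snd q = {} \<or>
        c + piece_width p \<le> y \<or> y + piece_width q \<le> c"
      by fastforce
    then show "sorted_wrt (\<lambda>(p, x) (q, y). snd p \<inter> snd q = {} \<or>
        x + piece_width p \<le> y \<or> y + piece_width q \<le> x) ((p, c) # qs)"
      using qs by simp
    show "\<forall>i\<in>{1..n}. \<forall>j. l i \<le> j \<longrightarrow> j < r i \<longrightarrow>
        (\<exists>(p, x)\<in>set ((p, c) # qs). i \<in> snd p \<and> x \<le> j \<and> j < x + piece_width p)"
    proof (intro ballI allI impI)
      fix i j assume ij: "i \<in> {1..n}" "l i \<le> j" "j < r i"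
      show "\<exists>(p, x)\<in>set ((p, c) # qs). i \<in> snd p \<and> x \<le> j \<and> j < x + piece_width p"
      \<comment> \<open>Cells beyond the new frontier are covered by induction; those between
        \<open>l i\<close> and \<open>l' i\<close> belong to \<open>p\<close>.\<close>
      proof (cases "l' i \<le> j")
        case True
        then have "\<exists>(p, x)\<in>set qs. i \<in> snd p \<and> x \<le> j \<and> j < x + piece_width p"
          using qs ij by blast
        then show ?thesis by auto
      next
        case False
        then have "i \<in> snd p" using packs_left.hyps(4)[OF ij(1)] ij by (auto split: if_splits)
        then show ?thesis using False ij l' by auto
      qed
    qed
  qed
  moreover have "\<forall>i\<in>{1..n}. l i \<le> r i"
    using le mono by force
  ultimately show ?case by blast
next
  case (packs_right l r' P p r c)
  then obtain qs where le: "\<forall>i\<in>{1..n}. l i \<le> r' i" and qs: "?placed l r' P qs"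
    by blast
  have r': "r i = c \<and> r' i = c - piece_width p" if "i \<in> snd p" for i
    using packs_right.hyps that by auto
  have mono: "r' i \<le> r i" if "i \<in> {1..n}" for i
    using packs_right.hyps(3,4) that by auto
  \<comment> \<open>Mirror image of the previous case; positions still record left ends, hence the
    shift by the width.\<close>
  let ?x = "c - piece_width p"
  have "?placed l r (add_mset p P) ((p, ?x) # qs)"
  proof (intro conjI)
    show "mset (map fst ((p, ?x) # qs)) = add_mset p P"
      using qs by simp
    have "x + piece_width q \<le> r i" if "(q, x) \<in> set qs" "i \<in> snd q" for q x i
    proof -
      have "i \<in> {1..n}" "x + piece_width q \<le> r' i"
        using qs that by fastforce+
      then show ?thesis using mono by force
    qed
    moreover have "l i \<le> ?x" if "i \<in> snd p" for i
      using r'[OF that] le packs_right.hyps(2) that by force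
    ultimately show "\<forall>(q, x)\<in>set ((p, ?x) # qs). snd q \<subseteq> {1..n} \<and>
        (\<forall>i\<in>snd q. l i \<le> x \<and> x + piece_width q \<le> r i)"
      using qs r' packs_right.hyps(2) by fastforce
    have "snd p \<inter> snd q = {} \<or> y + piece_width q \<le> ?x" if "(q, y) \<in> set qs" for q y
    proof (cases "snd p \<inter> snd q = {}")
      case False
      then obtain i where "i \<in> snd p" "i \<in> snd q" by blast
      then show ?thesis using qs r' that by fastforce
    qed simp
    then have "\<forall>(q, y)\<in>set qs. snd p \<inter> snd q = {} \<or>
        ?x + piece_width p \<le> y \<or> y + piece_width q \<le> ?x"
      by fastforce
    then show "sorted_wrt (\<lambda>(p, x) (q, y). snd p \<inter> snd q = {} \<or>
        x + piece_width p \<le> y \<or> y + piece_width q \<le> x) ((p, ?x) # qs)"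
      using qs by simp
    show "\<forall>i\<in>{1..n}. \<forall>j. l i \<le> j \<longrightarrow> j < r i \<longrightarrow>
        (\<exists>(p, x)\<in>set ((p, ?x) # qs). i \<in> snd p \<and> x \<le> j \<and> j < x + piece_width p)"
    proof (intro ballI allI impI)
      fix i j assume ij: "i \<in> {1..n}" "l i \<le> j" "j < r i"
      show "\<exists>(p, x)\<in>set ((p, ?x) # qs). i \<in> snd p \<and> x \<le> j \<and> j < x + piece_width p"
      proof (cases "j < r' i")
        case True
        then have "\<exists>(p, x)\<in>set qs. i \<in> snd p \<and> x \<le> j \<and> j < x + piece_width p"
          using qs ij by blast
        then show ?thesis by auto
      next
        case False
        then have "i \<in> snd p" using packs_right.hyps(4)[OF ij(1)] ij by (auto split: if_splits)
        then show ?thesis using False ij r' by auto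
      qed
    qed
  qed
  moreover have "\<forall>i\<in>{1..n}. l i \<le> r i"
    using le mono by force
  ultimately show ?case by blast
qed

section \<open>Rectangles as products of real intervals\<close>

lemma Union_unit_intervals:
  assumes "s \<le> t"
  shows "(\<Union>i\<in>{s..t}. {real i - 1..real i}) = {real s - 1..real t}"
  using assms
proof (induction t rule: dec_induct)
  case (step t)
  then have "{s..Suc t} = insert (Suc t) {s..t}" by auto
  then show ?case using step by auto
qed auto

lemma rect_region_eq:
  assumes "1 \<le> a" "1 \<le> b"
  shows "rect_region a b = {0..real b} \<times> {0..real a}"
proof -
  have "rect_region a b =
      (\<Union>j\<in>{1..b}. {real j - 1..real j}) \<times> (\<Union>i\<in>{1..a}. {real i - 1..real i})"
    unfolding rect_region_def unit_square_def by blast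
  then show ?thesis using assms by (simp only: Union_unit_intervals) simp
qed

text \<open>Row \<open>s\<close> starts at height \<open>s - 1\<close>, which gives the vertical
  offset.\<close>

lemma translate_rect_region:
  assumes "1 \<le> b" "s \<le> t" "1 \<le> s"
  shows "translate (x, real s - 1) (rect_region (card {s..t}) b) =
    {x..x + real b} \<times> {real s - 1..real t}"
proof -
  have "translate (x, real s - 1) (rect_region (card {s..t}) b) =
      (\<lambda>z. (x, real s - 1) + z) ` cbox (0, 0) (real b, 1 + real t - real s)"
    using assms by (simp add: translate_def rect_region_eq cbox_Pair_eq of_nat_diff)
  also have "\<dots> = cbox (x, real s - 1) (x + real b, real t)"
    by (subst cbox_translation[symmetric]) simp
  finally show ?thesis by (simp add: cbox_Pair_eq)
qed

text \<open>Each piece becomes a closed box at its integer column. Covered integer cells give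
  covered unit squares, and separation in integer columns or rows lets boxes meet only in their
  boundaries.\<close>

lemma packs_imp_has_tiling:
  assumes packs: "packs n (\<lambda>_. 0) (\<lambda>_. int m) P"
    and P: "\<And>a b \<iota>. ((a, b), \<iota>) \<in># P \<Longrightarrow> 1 \<le> b \<and> \<iota> \<in> intervals n \<and> card \<iota> = a"
  shows "has_tiling n m P"
proof -
  from packs_imp_placement[OF packs] obtain qs :: "((rect_poly \<times> nat set) \<times> int) list" where
    mset: "mset (map fst qs) = P" and
    bounds0: "\<forall>(p, x)\<in>set qs. snd p \<subseteq> {1..n} \<and>
      (\<forall>i\<in>snd p. 0 \<le> x \<and> x + piece_width p \<le> int m)" and
    disj: "sorted_wrt (\<lambda>(p, x) (q, y). snd p \<inter> snd q = {} \<or>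
        x + piece_width p \<le> y \<or> y + piece_width q \<le> x) qs" and
    cover0: "\<forall>i\<in>{1..n}. \<forall>j. 0 \<le> j \<longrightarrow> j < int m \<longrightarrow>
        (\<exists>(p, x)\<in>set qs. i \<in> snd p \<and> x \<le> j \<and> j < x + piece_width p)"
    by (elim conjE exE) (rule that)
  have bounds: "0 \<le> x \<and> x + piece_width p \<le> int m" if "(p, x) \<in> set qs" "i \<in> snd p" for p x i
    using bspec[OF bounds0 that(1)] that(2) by auto
  have cover: "\<exists>(p, x)\<in>set qs. i \<in> snd p \<and> x \<le> j \<and> j < x + piece_width p"
    if "i \<in> {1..n}" "0 \<le> j" "j < int m" for i j
    using cover0 that by simp
  define ps where "ps = map fst qs"
  \<comment> \<open>\<open>Min\<close> and \<open>Max\<close> recover the end rows, since the row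
    set is an interval.\<close>
  define box :: "(rect_poly \<times> nat set) \<times> int \<Rightarrow> (real \<times> real) set" where
    "box = (\<lambda>(p, x). {real_of_int x..real_of_int x + real (snd (fst p))} \<times>
      {real (Min (snd p)) - 1..real (Max (snd p))})"
  define v where
    "v k = (real_of_int (snd (qs ! k)), real (Min (snd (fst (qs ! k)))) - 1)" for k
  have piece: "\<exists>s t. snd p = {s..t} \<and> 1 \<le> s \<and> s \<le> t \<and> t \<le> n \<and> 1 \<le> snd (fst p) \<and>
      fst (fst p) = card {s..t} \<and> Min (snd p) = s \<and> Max (snd p) = t"
    if "(p, x) \<in> set qs" for p x
  proof -
    obtain a b \<iota> where p: "p = ((a, b), \<iota>)" by (metis prod.exhaust)
    have "p \<in># P" using that mset by force
    then have "1 \<le> b" "\<iota> \<in> intervals n" "card \<iota> = a" using P p by blast+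
    then obtain s t where "\<iota> = {s..t}" "1 \<le> s" "s \<le> t" "t \<le> n"
      unfolding intervals_def by blast
    then show ?thesis using p \<open>1 \<le> b\<close> \<open>card \<iota> = a\<close>
      by (intro exI[of _ s] exI[of _ t]) (auto intro!: Min_eqI Max_eqI)
  qed
  \<comment> \<open>The box as a union of row strips, the form in which
    \<open>occupies_exactly_rows\<close> and the covering are checked.\<close>
  have box_rows: "box (p, x) = {real_of_int x..real_of_int x + real (snd (fst p))} \<times>
      (\<Union>i\<in>snd p. {real i - 1..real i})" if px: "(p, x) \<in> set qs" for p x
  proof -
    obtain s t where "snd p = {s..t}" "s \<le> t" "Min (snd p) = s" "Max (snd p) = t"
      using piece[OF px] by blast
    then show ?thesis by (simp add: box_def Union_unit_intervals)
  qed
  have place: "case ps ! k of ((a, b), \<iota>) \<Rightarrow>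
      box (qs ! k) = translate (v k) (rect_region a b) \<and> occupies_exactly_rows (box (qs ! k)) \<iota>"
    if "k < length ps" for k
  proof -
    obtain a b \<iota> x where q: "qs ! k = (((a, b), \<iota>), x)" by (metis prod.exhaust)
    have mem: "(((a, b), \<iota>), x) \<in> set qs"
      using that q by (metis length_map nth_mem ps_def)
    obtain s t where st: "\<iota> = {s..t}" "1 \<le> s" "s \<le> t" "1 \<le> b" "a = card {s..t}"
        "Min \<iota> = s" "Max \<iota> = t"
      using piece[OF mem] by auto
    have "box (qs ! k) = translate (v k) (rect_region a b)"
      using st translate_rect_region[of b s t "real_of_int x"] by (simp add: q box_def v_def)
    moreover have "occupies_exactly_rows (box (qs ! k)) \<iota>"
      using box_rows[OF mem] by (simp add: q occupies_exactly_rows_def)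
    moreover have "ps ! k = ((a, b), \<iota>)"
      using that q by (simp add: ps_def)
    ultimately show ?thesis by simp
  qed
  have "(\<Union>q\<in>set qs. box q) = rect_region n m"
  proof
    show "(\<Union>q\<in>set qs. box q) \<subseteq> rect_region n m"
    proof
      fix z assume "z \<in> (\<Union>q\<in>set qs. box q)"
      then obtain p x where px: "(p, x) \<in> set qs" "z \<in> box (p, x)" by auto
      obtain s t where st: "snd p = {s..t}" "1 \<le> s" "s \<le> t" "t \<le> n" "1 \<le> snd (fst p)"
          "Min (snd p) = s" "Max (snd p) = t"
        using piece[OF px(1)] by blast
      have x: "0 \<le> x" "x + piece_width p \<le> int m"
        using bounds[OF px(1), of s] st by auto
      \<comment> \<open>\<open>rect_region_eq\<close> asks for positive dimensions; a piece lying
        inside provides them.\<close>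
      then have "1 \<le> m" "1 \<le> n" using st by auto
      moreover have "real_of_int x + real (snd (fst p)) \<le> real m"
        using x(2) by linarith
      ultimately show "z \<in> rect_region n m"
        using px(2) st x(1) by (auto simp: box_def rect_region_eq)
    qed
    show "rect_region n m \<subseteq> (\<Union>q\<in>set qs. box q)"
    proof
      fix z assume "z \<in> rect_region n m"
      then obtain i j where ij: "i \<in> {1..n}" "j \<in> {1..m}" "z \<in> unit_square i j"
        unfolding rect_region_def by blast
      \<comment> \<open>Column \<open>j\<close> is the cell whose left end is
        \<open>j - 1\<close>.\<close>
      obtain p x where px: "(p, x) \<in> set qs" "i \<in> snd p" "x \<le> int j - 1"
          "int j - 1 < x + piece_width p"
        using cover[of i "int j - 1"] ij by auto
      have "real_of_int x \<le> real j - 1" "real j \<le> real_of_int x + real (snd (fst p))"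
        using px(3,4) by linarith+
      then have "z \<in> box (p, x)"
        using px ij(3) by (auto simp: box_rows unit_square_def)
      then show "z \<in> (\<Union>q\<in>set qs. box q)" using px(1) by blast
    qed
  qed
  then have union: "(\<Union>k<length ps. box (qs ! k)) = rect_region n m"
    by (auto simp: ps_def set_conv_nth)
  have "interior (box (qs ! k) \<inter> box (qs ! l)) = {}" if kl: "k < l" "l < length qs" for k l
  proof -
    obtain p x q y where q: "qs ! k = (p, x)" "qs ! l = (q, y)" by (metis prod.exhaust)
    have mem: "(p, x) \<in> set qs" "(q, y) \<in> set qs"
      using q kl by (metis nth_mem order.strict_trans)+
    obtain s t s' t' where st: "snd p = {s..t}" "s \<le> t" "Min (snd p) = s" "Max (snd p) = t"
        "snd q = {s'..t'}" "s' \<le> t'" "Min (snd q) = s'" "Max (snd q) = t'"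
      using piece[OF mem(1)] piece[OF mem(2)] by metis
    have "snd p \<inter> snd q = {} \<or> x + piece_width p \<le> y \<or> y + piece_width q \<le> x"
      using sorted_wrt_nth_less[OF disj kl] by (simp add: q)
    then consider "t < s'" | "t' < s" | "x + piece_width p \<le> y" | "y + piece_width q \<le> x"
    proof (elim disjE)
      assume *: "snd p \<inter> snd q = {}"
      have "t < s' \<or> t' < s"
      proof (rule ccontr)
        assume "\<not> ?thesis"
        \<comment> \<open>If neither interval ends before the other starts, the larger of the two
          left ends lies in both.\<close>
        then have "max s s' \<in> snd p \<inter> snd q" using st by auto
        then show False using * by blast
      qed
      then show ?thesis using that by blast
    qed
    \<comment> \<open>Strict order of row numbers leaves a full unit, so the lower box ends at or
      below the start of the upper one; in each case the intersection has a factor with empty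
      interior.\<close>
    then consider "real t \<le> real s' - 1" | "real t' \<le> real s - 1"
      | "real_of_int x + real (snd (fst p)) \<le> real_of_int y"
      | "real_of_int y + real (snd (fst q)) \<le> real_of_int x"
      by cases linarith+
    then show ?thesis
      unfolding q box_def prod.case st(3,4,7,8) by cases (auto simp: interior_Times interior_Int)
  qed
  then have "interior (box (qs ! k) \<inter> box (qs ! l)) = {}"
    if "k < length ps" "l < length ps" "k \<noteq> l" for k l
    using that by (metis Int_commute length_map linorder_neqE_nat ps_def)
  then show ?thesis
    unfolding has_tiling_def using mset place union
    by (intro exI[of _ ps] exI[of _ v] exI[of _ "\<lambda>k. box (qs ! k)"]) (simp add: ps_def)
qed

section \<open>The two families of polyomino sets, by explicit packing orders\<close>

subsection \<open>Representability\<close>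

text \<open>Reduces representability to packing between two straight walls at 0 and
  \<open>m\<close>, with the row sums in the form of \<open>row_width\<close>.\<close>

lemma n_representableI:
  assumes L: "L \<subseteq> rect_polyominoes"
    and packs: "\<And>m P. (\<And>p. p \<in># P \<Longrightarrow>
        fst p \<in> L \<and> (\<exists>s t. snd p = {s..t} \<and> 1 \<le> s \<and> s \<le> t \<and> t \<le> n \<and>
          fst (fst p) = Suc t - s)) \<Longrightarrow>
      (\<And>i. i \<in> {1..n} \<Longrightarrow> row_width i P = int m) \<Longrightarrow> packs n (\<lambda>_. 0) (\<lambda>_. int m) P"
  shows "n_representable n L"
  unfolding n_representable_def
proof (intro allI impI, elim conjE)
  fix m and P :: "(rect_poly \<times> nat set) multiset"
  assume P: "\<forall>((a, b), \<iota>)\<in>set_mset P. (a, b) \<in> L \<and> \<iota> \<in> intervals n \<and> card \<iota> = a"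
    and rows: "\<forall>i\<in>{1..n}. (\<Sum>((a, b), \<iota>)\<in>#filter_mset (\<lambda>(p, \<iota>). i \<in> \<iota>) P. b) = m"
  have width: "row_width i Q = int (\<Sum>((a, b), \<iota>)\<in>#filter_mset (\<lambda>(p, \<iota>). i \<in> \<iota>) Q. b)" for i Q
    by (induction Q) (auto simp: row_width_def)
  show "has_tiling n m P"
  proof (rule packs_imp_has_tiling)
    show "packs n (\<lambda>_. 0) (\<lambda>_. int m) P"
    proof (rule packs)
      show "fst p \<in> L \<and> (\<exists>s t. snd p = {s..t} \<and> 1 \<le> s \<and> s \<le> t \<and> t \<le> n \<and>
          fst (fst p) = Suc t - s)" if "p \<in># P" for p
        using P that unfolding intervals_def by fastforce
      show "row_width i P = int m" if "i \<in> {1..n}" for i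
        using rows that by (simp add: width)
    qed
    show "1 \<le> b \<and> \<iota> \<in> intervals n \<and> card \<iota> = a" if "((a, b), \<iota>) \<in># P" for a b \<iota>
      using P L that unfolding rect_polyominoes_def by fastforce
  qed
qed

text \<open>An interval of height at least \<open>n - 1\<close> misses at most one row, necessarily
  the first or the last. So every piece outside the three blocks occupies a single row.\<close>

lemma n_representable_heights_1_or_large:
  assumes "L \<subseteq> rect_polyominoes" and heights: "\<forall>(a, b)\<in>L. a = 1 \<or> a \<ge> n - 1"
  shows "n_representable n L"
  using assms(1)
proof (rule n_representableI)
  fix m and P :: "(rect_poly \<times> nat set) multiset"
  assume P: "\<And>p. p \<in># P \<Longrightarrow> fst p \<in> L \<and>
      (\<exists>s t. snd p = {s..t} \<and> 1 \<le> s \<and> s \<le> t \<and> t \<le> n \<and> fst (fst p) = Suc t - s)"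
    and rows: "\<And>i. i \<in> {1..n} \<Longrightarrow> row_width i P = int m"
  \<comment> \<open>Each class is filtered from what the earlier ones leave, so the decomposition is
    a partition whatever coincidences occur for small \<open>n\<close>.\<close>
  define F where "F = {#p \<in># P. snd p = {1..n}#}"
  define F' where "F' = {#p \<in># P. snd p \<noteq> {1..n}#}"
  define T where "T = {#p \<in># F'. snd p = {1..n-1}#}"
  define T' where "T' = {#p \<in># F'. snd p \<noteq> {1..n-1}#}"
  define B where "B = {#p \<in># T'. snd p = {2..n}#}"
  define S where "S = {#p \<in># T'. snd p \<noteq> {2..n}#}"
  have decomp: "P = F + (T + (B + S))"
    by (simp only: F_def F'_def T_def T'_def B_def S_def multiset_partition[symmetric])
  have block: "\<And>p. p \<in># F \<Longrightarrow> snd p = {1..n}" "\<And>p. p \<in># T \<Longrightarrow> snd p = {1..n-1}"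
      "\<And>p. p \<in># B \<Longrightarrow> snd p = {2..n}"
    by (auto simp: F_def T_def B_def)
  have S: "\<exists>i\<in>{1..n}. snd p = {i}" if "p \<in># S" for p
  proof -
    have p: "p \<in># P" "snd p \<noteq> {1..n}" "snd p \<noteq> {1..n-1}" "snd p \<noteq> {2..n}"
      using that by (auto simp: S_def T'_def F'_def)
    obtain s t where st: "snd p = {s..t}" "1 \<le> s" "s \<le> t" "t \<le> n" "fst (fst p) = Suc t - s"
      using P[OF p(1)] by blast
    have "fst (fst p) = 1 \<or> fst (fst p) \<ge> n - 1"
      using P[OF p(1)] heights by force
    moreover have "\<not> (s = 1 \<and> t = n)" "\<not> (s = 1 \<and> t = n - 1)" "\<not> (s = 2 \<and> t = n)"
      using p(2-4) st(1) by auto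
    ultimately have "s = t" using st(2-5) by linarith
    then show ?thesis using st by auto
  qed
  have width: "row_width i F = (if i \<in> {1..n} then total_width F else 0)"
      "row_width i T = (if i \<in> {1..n-1} then total_width T else 0)"
      "row_width i B = (if i \<in> {2..n} then total_width B else 0)" for i
    using block by (intro row_width_block; blast)+
  show "packs n (\<lambda>_. 0) (\<lambda>_. int m) P"
    unfolding decomp
  proof (rule packs_left_block[OF block(1)])
    show "packs n (\<lambda>i. if i \<in> {1..n} then 0 + total_width F else 0) (\<lambda>_. int m) (T + (B + S))"
    proof (rule packs_left_block[OF block(2)])
      show "packs n (\<lambda>i. if i \<in> {1..n-1} then total_width F + total_width T
          else if i \<in> {1..n} then 0 + total_width F else 0) (\<lambda>_. int m) (B + S)"
      \<comment> \<open>The left wall may have a step at row \<open>n\<close>, but the right wall is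
        still straight.\<close>
      proof (rule packs_right_block[OF block(3)], assumption)
        show "packs n (\<lambda>i. if i \<in> {1..n-1} then total_width F + total_width T
          else if i \<in> {1..n} then 0 + total_width F else 0)
          (\<lambda>i. if i \<in> {2..n} then int m - total_width B else int m) S"
        proof (rule packs_singletons[OF S], assumption)
          fix i assume i: "i \<in> {1..n}"
          show "(if i \<in> {1..n-1} then total_width F + total_width T
              else if i \<in> {1..n} then 0 + total_width F else 0) + row_width i S =
            (if i \<in> {2..n} then int m - total_width B else int m)"
            using rows[OF i] i unfolding decomp row_width_union width
            by (auto split: if_splits)
        qed
      qed auto
    qed auto
  qed auto
qed

text \<open>Turns a class of identical pieces into a number, so that the two kinds of pieces to be
  paired can be compared by their counts.\<close>

lemma constant_block_eq_replicate:
  assumes "\<And>p. p \<in># Q \<Longrightarrow> p = q"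
  shows "Q = replicate_mset (size Q) q"
  using assms by (induction Q) auto

text \<open>Surplus \<open>{1..2}\<close> pieces spoil the left wall on rows 2 and 3, surplus
  \<open>{3..4}\<close> pieces the right one. After pairing at most one kind has a surplus, so one
  of the walls stays straight for the \<open>{2..3}\<close> pieces.\<close>

lemma n_representable_4_equal_widths:
  assumes "L \<subseteq> rect_polyominoes"
    and widths: "\<forall>(a, b)\<in>L. \<forall>(a', b')\<in>L. a = 2 \<and> a' = 2 \<longrightarrow> b = b'"
  shows "n_representable 4 L"
  using assms(1)
proof (rule n_representableI)
  fix m and P :: "(rect_poly \<times> nat set) multiset"
  assume P: "\<And>p. p \<in># P \<Longrightarrow> fst p \<in> L \<and>
      (\<exists>s t. snd p = {s..t} \<and> 1 \<le> s \<and> s \<le> t \<and> t \<le> 4 \<and> fst (fst p) = Suc t - s)"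
    and rows: "\<And>i. i \<in> {1..4} \<Longrightarrow> row_width i P = int m"
  define rest where "rest \<iota> Q = {#p \<in># Q. snd p \<noteq> \<iota>#}"
    for \<iota> and Q :: "(rect_poly \<times> nat set) multiset"
  define part where "part \<iota> Q = {#p \<in># Q. snd p = \<iota>#}"
    for \<iota> and Q :: "(rect_poly \<times> nat set) multiset"
  define F where "F = part {1..4} P"
  define P1 where "P1 = rest {1..4} P"
  define T where "T = part {1..3} P1"
  define P2 where "P2 = rest {1..3} P1"
  define B where "B = part {2..4} P2"
  define P3 where "P3 = rest {2..4} P2"
  define A0 where "A0 = part {1..2} P3"
  define P4 where "P4 = rest {1..2} P3"
  define D where "D = part {2..3} P4"
  define P5 where "P5 = rest {2..3} P4"
  define C0 where "C0 = part {3..4} P5"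
  define S where "S = rest {3..4} P5"
  have split: "Q = part \<iota> Q + rest \<iota> Q" for \<iota> Q
    by (simp only: part_def rest_def multiset_partition[symmetric])
  have decomp: "P = F + (T + (B + (A0 + (D + (C0 + S)))))"
    by (simp only: F_def P1_def T_def P2_def B_def P3_def A0_def P4_def D_def P5_def C0_def S_def
        split[symmetric])
  note part_defs = F_def P1_def T_def P2_def B_def P3_def A0_def P4_def D_def P5_def C0_def S_def
    part_def rest_def
  have S: "\<exists>i\<in>{1..4}. snd p = {i}" if "p \<in># S" for p
  proof -
    have p: "p \<in># P" "snd p \<noteq> {1..4}" "snd p \<noteq> {1..3}" "snd p \<noteq> {2..4}" "snd p \<noteq> {1..2}"
        "snd p \<noteq> {2..3}" "snd p \<noteq> {3..4}"
      using that by (auto simp: part_defs)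
    obtain s t where st: "snd p = {s..t}" "1 \<le> s" "s \<le> t" "t \<le> 4"
      using P[OF p(1)] by blast
    have "\<not> (s = 1 \<and> t = 4)" "\<not> (s = 1 \<and> t = 3)" "\<not> (s = 2 \<and> t = 4)" "\<not> (s = 1 \<and> t = 2)"
        "\<not> (s = 2 \<and> t = 3)" "\<not> (s = 3 \<and> t = 4)"
      using p(2-7) st(1) by metis+
    \<comment> \<open>Exactly six intervals of \<open>{1..4}\<close> have more than one element, and
      all are excluded.\<close>
    then have "s = t" using st(2-4) by presburger
    then show ?thesis using st by auto
  qed
  \<comment> \<open>If \<open>L\<close> has no element of height two, the property is vacuous and
    any \<open>w\<close> serves.\<close>
  obtain w where w: "\<And>b. (2, b) \<in> L \<Longrightarrow> b = w"
  proof (cases "\<exists>w. (2, w) \<in> L")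
    case True
    then obtain w where w: "(2, w) \<in> L" by blast
    have "b = w" if "(2, b) \<in> L" for b
      using bspec[OF widths that] w by auto
    then show ?thesis by (rule that)
  qed blast
  \<comment> \<open>Two consecutive rows force height 2, hence width \<open>w\<close>, so the rows
    determine the piece.\<close>
  have domino: "p = ((2, w), {s..t})" if p: "p \<in># P" "snd p = {s..t}" "t = s + 1" for p s t
  proof -
    obtain a b where ab: "p = ((a, b), {s..t})"
      using p(2) by (metis prod.collapse)
    have "a = 2" "(a, b) \<in> L"
      using P[OF p(1)] p(3) by (auto simp: ab Icc_eq_Icc)
    then show ?thesis using w ab by simp
  qed
  have "p = ((2, w), {1..2})" if "p \<in># A0" for p
    using that by (intro domino) (auto simp: part_defs)
  then obtain a where a: "A0 = replicate_mset a ((2, w), {1..2})"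
    by (rule that[OF constant_block_eq_replicate])
  have "p = ((2, w), {3..4})" if "p \<in># C0" for p
    using that by (intro domino) (auto simp: part_defs)
  then obtain c where c: "C0 = replicate_mset c ((2, w), {3..4})"
    by (rule that[OF constant_block_eq_replicate])
  \<comment> \<open>Written as functions of the count, so that the larger class splits into paired
    pieces and surplus.\<close>
  define A where "A k = replicate_mset k ((2 :: nat, w), {1..2 :: nat})" for k
  define C where "C k = replicate_mset k ((2 :: nat, w), {3..4 :: nat})" for k
  have block: "\<And>p. p \<in># F \<Longrightarrow> snd p = {1..4}" "\<And>p. p \<in># T \<Longrightarrow> snd p = {1..3}"
      "\<And>p. p \<in># B \<Longrightarrow> snd p = {2..4}" "\<And>p. p \<in># D \<Longrightarrow> snd p = {2..3}"
      "\<And>k p. p \<in># A k \<Longrightarrow> snd p = {1..2}" "\<And>k p. p \<in># C k \<Longrightarrow> snd p = {3..4}"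
    by (simp_all add: part_defs A_def C_def split: if_splits)
  \<comment> \<open>The first equation is where the common width enters.\<close>
  have AC: "total_width (A k) = total_width (C k)" "A (k + k') = A k + A k'"
      "C (k + k') = C k + C k'" for k k'
    by (auto simp: A_def C_def total_width_replicate intro!: multiset_eqI)
  have width: "row_width i F = (if i \<in> {1..4} then total_width F else 0)"
      "row_width i T = (if i \<in> {1..3} then total_width T else 0)"
      "row_width i B = (if i \<in> {2..4} then total_width B else 0)"
      "row_width i D = (if i \<in> {2..3} then total_width D else 0)"
      "row_width i (A k) = (if i \<in> {1..2} then total_width (A k) else 0)"
      "row_width i (C k) = (if i \<in> {3..4} then total_width (C k) else 0)" for i k
    by (rule row_width_block, erule block)+
  note left = packs_left_block[where n = 4] and right = packs_right_block[where n = 4]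
  have P_eq: "P = F + T + B + A a + D + C c + S"
    using decomp a c by (simp add: A_def C_def ac_simps)
  have row: "i = 1 \<or> i = 2 \<or> i = 3 \<or> i = 4" if "i \<in> {1..4}" for i :: nat
    using that by auto
  show "packs 4 (\<lambda>_. 0) (\<lambda>_. int m) P"
  proof (cases "c \<le> a")
    case True
    \<comment> \<open>\<open>A c\<close> and \<open>C c\<close> together act as a block on all four
      rows; \<open>A d\<close> is the surplus.\<close>
    then obtain d where "a = c + d" using le_Suc_ex by blast
    then have P': "P = F + (A c + (C c + (T + (B + (A d + (D + S))))))"
      unfolding P_eq by (simp only: AC ac_simps)
    show ?thesis
      unfolding P'
      apply (rule left[OF block(1), where c = 0], assumption, force, force)
      apply (rule left[OF block(5), where c = "total_width F"], assumption, force, force)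
      apply (rule left[OF block(6), where c = "total_width F"], assumption, force, force)
      \<comment> \<open>The wall is straight across rows 2 and 3 because \<open>A c\<close> and
        \<open>C c\<close> have equal total width.\<close>
      apply (rule left[OF block(2), where c = "total_width F + total_width (C c)"],
          assumption, force, force simp: AC)
      apply (rule right[OF block(3), where c = "int m"], assumption, force, force)
      apply (rule left[OF block(5), where c = "total_width F + total_width (C c) + total_width T"],
          assumption, force, force)
      \<comment> \<open>On the right, rows 2 and 3 have been moved only by \<open>B\<close>, and
        equally.\<close>
      apply (rule right[OF block(4), where c = "int m - total_width B"], assumption, force, force)
      apply (rule packs_singletons[OF S], assumption)
      subgoal for i
        using row[of i] rows[of i] unfolding P' row_width_union width by (auto simp: AC)
      done
  next
    case False
    \<comment> \<open>Here the surplus \<open>C d\<close> lies on rows 3 and 4, so the sides are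
      exchanged: \<open>C d\<close> goes to the right and \<open>D\<close> to the left.\<close>
    then obtain d where "c = a + d" using le_Suc_ex nat_le_linear by blast
    then have P': "P = F + (A a + (C a + (T + (B + (C d + (D + S))))))"
      unfolding P_eq by (simp only: AC ac_simps)
    show ?thesis
      unfolding P'
      apply (rule left[OF block(1), where c = 0], assumption, force, force)
      apply (rule left[OF block(5), where c = "total_width F"], assumption, force, force)
      apply (rule left[OF block(6), where c = "total_width F"], assumption, force, force)
      apply (rule left[OF block(2), where c = "total_width F + total_width (C a)"],
          assumption, force, force simp: AC)
      apply (rule right[OF block(3), where c = "int m"], assumption, force, force)
      apply (rule right[OF block(6), where c = "int m - total_width B"], assumption, force, force)
      apply (rule left[OF block(4), where c = "total_width F + total_width (C a) + total_width T"],
          assumption, force, force)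
      apply (rule packs_singletons[OF S], assumption)
      subgoal for i
        using row[of i] rows[of i] unfolding P' row_width_union width by (auto simp: AC)
      done
  qed
qed

theorem theorem4p5:
  shows "(\<forall>(n :: nat) (L :: rect_poly set).
            finite L \<and> L \<subseteq> rect_polyominoes \<and> (\<forall>(a, b)\<in>L. a = 1 \<or> a \<ge> n - 1)
            \<longrightarrow> n_representable n L) \<and>
         (\<forall>L :: rect_poly set.
            finite L \<and> L \<subseteq> rect_polyominoes \<and>
            (\<forall>(a, b)\<in>L. \<forall>(a', b')\<in>L. a = 2 \<and> a' = 2 \<longrightarrow> b = b')
            \<longrightarrow> n_representable 4 L)"
proof (intro conjI allI impI; elim conjE)
  fix n L
  assume "L \<subseteq> rect_polyominoes" "\<forall>(a, b)\<in>L. a = 1 \<or> a \<ge> n - 1"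
  then show "n_representable n L" by (rule n_representable_heights_1_or_large)
next
  fix L
  assume "L \<subseteq> rect_polyominoes"
    and "\<forall>(a, b)\<in>L. \<forall>(a', b')\<in>L. a = 2 \<and> a' = 2 \<longrightarrow> b = b'"
  then show "n_representable 4 L" by (rule n_representable_4_equal_widths)
qed

end
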